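(* Let $n\ge 1$, let $P$ be a finite partially ordered set, let $R$ be a partially ordered set, and let $\phi:[n]\times P\to R$ be an isotone map which has left strict chain fibers. Let $\phi_1:\langle x_{[n]\times P}\rangle\to\langle x_R\rangle$ be the linear map with $x_{i,p}\mapsto x_{\phi(i,p)}$, and let $B$ be a basis of $\ker\phi_1$ consisting of differences $x_{i,p}-x_{i',p'}$ with $\phi(i,p)=\phi(i',p')$. Then $B$ is a regular sequence for the ring $\Bbbk[x_{[n]\times P}]/L(n,P)$.
   Context: $\Bbbk$ is a field and $[n]=\{1<2<\cdots<n\}$ is the chain on $n$ elements. For a set $A$, $\Bbbk[x_A]$ is the polynomial ring in variables $x_a$, $a\in A$, and $\langle x_A\rangle$ is the $\Bbbk$-vector space spanned by these variables. A map of posets is isotone if it is order preserving. Products of posets carry the componentwise order, and $P^{op}$ is the opposite poset of $P$. The $n$'th letterplace ideal $L(n,P)\subseteq\Bbbk[x_{[n]\times P}]$ is generated by all monomials $x_{1,p_1}x_{2,p_2}\cdots x_{n,p_n}$ with $p_1\le p_2\le\cdots\le p_n$ in $P$. A chain in a product of posets $Q\times P$ is left strict if for any two of its elements, $(q,p)<(q',p')$ implies $q<q'$. An isotone map $\phi:Q\times P\to R$ has left strict chain fibers if every fiber $\phi^{-1}(r)$ is a left strict chain in $Q\times P^{op}$. A sequence of elements is regular for a ring if each element is a nonzerodivisor on the quotient of the ring by the preceding elements (the elements here are homogeneous of degree one, so the quotient of a nonzero graded quotient ring by them is automatically nonzero). *)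

theory Defs
  imports
    Complex_Main
    "HOL-Algebra.QuotRing"
    "HOL-Library.Poly_Mapping"
    "HOL-Library.Product_Order"
    "HOL-Library.Dual_Ordered_Lattice"
begin

section \<open>Polynomial rings\<close>

text \<open>
  A polynomial is a finitely supported map from monomials to coefficients, and a monomial is a
  finitely supported map from variables to exponents. The type of variables is only an ambient
  type: the ring \<open>k[x_A]\<close> of polynomials in the variables indexed by the set \<open>A\<close> is
  \<open>poly_ring A\<close> below.
\<close>

type_synonym ('v, 'k) mpoly = "('v \<Rightarrow>\<^sub>0 nat) \<Rightarrow>\<^sub>0 'k"

definition var :: "'v \<Rightarrow> ('v, 'k::comm_ring_1) mpoly" where
  "var v = Poly_Mapping.single (Poly_Mapping.single v 1) 1"

definition poly_ring :: "'v set \<Rightarrow> ('v, 'k::comm_ring_1) mpoly ring" where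
  "poly_ring A =
     \<lparr>carrier = {f. \<forall>m\<in>Poly_Mapping.keys f. Poly_Mapping.keys m \<subseteq> A},
      monoid.mult = (*), one = 1, zero = 0, add = (+)\<rparr>"

lemma var_in_poly_ring: "v \<in> A \<Longrightarrow> (var v :: ('v, 'k::comm_ring_1) mpoly) \<in> carrier (poly_ring A)"
  by (auto simp: var_def poly_ring_def)

lemma cring_poly_ring: "cring (poly_ring A :: ('v, 'k::comm_ring_1) mpoly ring)"
proof (rule cringI)
  let ?S = "poly_ring A :: ('v, 'k) mpoly ring"
  have add_closed: "f + g \<in> carrier ?S" if "f \<in> carrier ?S" "g \<in> carrier ?S" for f g
    using that Poly_Mapping.keys_add[of f g] by (fastforce simp: poly_ring_def)
  have uminus_closed: "- f \<in> carrier ?S" if "f \<in> carrier ?S" for f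
    using that by (auto simp: poly_ring_def in_keys_iff)
  have mult_closed: "f * g \<in> carrier ?S" if "f \<in> carrier ?S" "g \<in> carrier ?S" for f g
  proof -
    have "Poly_Mapping.keys m \<subseteq> A" if m: "m \<in> Poly_Mapping.keys (f * g)" for m
    proof -
      obtain a b where ab: "m = a + b" "a \<in> Poly_Mapping.keys f" "b \<in> Poly_Mapping.keys g"
        using m Poly_Mapping.keys_mult[of f g] by blast
      then have "Poly_Mapping.keys a \<subseteq> A" "Poly_Mapping.keys b \<subseteq> A"
        using \<open>f \<in> carrier ?S\<close> \<open>g \<in> carrier ?S\<close> by (auto simp: poly_ring_def)
      then show ?thesis
        using Poly_Mapping.keys_add[of a b] ab(1) by blast
    qed
    then show ?thesis by (simp add: poly_ring_def)
  qed
  have sel: "\<one>\<^bsub>?S\<^esub> = 1" "\<zero>\<^bsub>?S\<^esub> = 0"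
      "\<And>f g. f \<otimes>\<^bsub>?S\<^esub> g = f * g" "\<And>f g. f \<oplus>\<^bsub>?S\<^esub> g = f + g"
    by (simp_all add: poly_ring_def)
  have one_closed: "1 \<in> carrier ?S" and zero_closed: "0 \<in> carrier ?S"
    by (simp_all add: poly_ring_def)
  show "abelian_group ?S"
  proof (rule abelian_groupI, unfold sel)
    show "\<exists>g\<in>carrier ?S. g + f = 0" if "f \<in> carrier ?S" for f
      using uminus_closed[OF that] by (intro bexI[of _ "- f"]) auto
  qed (simp_all add: add_closed zero_closed ac_simps)
  show "Group.comm_monoid ?S"
    by (rule comm_monoidI, unfold sel) (simp_all add: mult_closed one_closed ac_simps)
  show "(f \<oplus>\<^bsub>?S\<^esub> g) \<otimes>\<^bsub>?S\<^esub> h = f \<otimes>\<^bsub>?S\<^esub> h \<oplus>\<^bsub>?S\<^esub> g \<otimes>\<^bsub>?S\<^esub> h" for f g h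
    by (simp only: sel distrib_right)
qed


section \<open>Linear forms\<close>

definition poly_scale :: "'k::field \<Rightarrow> ('v, 'k) mpoly \<Rightarrow> ('v, 'k) mpoly" where
  "poly_scale c = Poly_Mapping.map ((*) c)"

lemma poly_scale_conv_mult: "poly_scale c f = Poly_Mapping.single 0 c * f"
  by (simp add: poly_scale_def mult_map_scale_conv_mult)

lemma lookup_poly_scale: "Poly_Mapping.lookup (poly_scale c f) m = c * Poly_Mapping.lookup f m"
  by (simp add: poly_scale_def map.rep_eq when_def)

global_interpretation poly: vector_space "poly_scale :: 'k::field \<Rightarrow> ('v, 'k) mpoly \<Rightarrow> ('v, 'k) mpoly"
  by standard
    (auto intro!: poly_mapping_eqI simp: lookup_poly_scale lookup_add algebra_simps)

definition linear_forms :: "'v set \<Rightarrow> ('v, 'k::field) mpoly set" where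
  "linear_forms A = poly.span (var ` A)"

text \<open>
  For finite \<open>A\<close>, \<open>linear_map A \<phi>\<close> is, on \<open>linear_forms A\<close>, the linear map sending the variable
  indexed by \<open>a\<close> to the variable indexed by \<open>\<phi> a\<close>. Being a HOL function it is total, so its kernel
  has to be taken inside \<open>linear_forms A\<close>.
\<close>

definition linear_map :: "'v set \<Rightarrow> ('v \<Rightarrow> 'w) \<Rightarrow> ('v, 'k::field) mpoly \<Rightarrow> ('w, 'k) mpoly" where
  "linear_map A \<phi> f =
     (\<Sum>a\<in>A. poly_scale (Poly_Mapping.lookup f (Poly_Mapping.single a 1)) (var (\<phi> a)))"

lemma linear_linear_map: "Vector_Spaces.linear poly_scale poly_scale (linear_map A \<phi>)"
  by unfold_locales
    (simp_all add: linear_map_def lookup_add lookup_poly_scale poly.scale_left_distrib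
      sum.distrib poly.scale_sum_right)

lemma linear_map_var:
  assumes "finite A" "a \<in> A"
  shows "linear_map A \<phi> (var a :: ('v, 'k::field) mpoly) = var (\<phi> a)"
proof -
  have *: "Poly_Mapping.lookup (var a :: ('v, 'k) mpoly) (Poly_Mapping.single b 1)
      = (if b = a then 1 else 0)" for b
    by (metis One_nat_def lookup_single_eq lookup_single_not_eq nat.simps(3) var_def)
  have "linear_map A \<phi> (var a :: ('v, 'k) mpoly) = (\<Sum>b\<in>A. if b = a then var (\<phi> b) else 0)"
    unfolding linear_map_def * by (intro sum.cong) auto
  with assms show ?thesis by simp
qed

lemma linear_map_in_linear_forms:
  "\<phi> \<in> A \<rightarrow> R \<Longrightarrow> linear_map A \<phi> f \<in> linear_forms R"
  unfolding linear_map_def linear_forms_def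
  by (intro poly.span_sum poly.span_scale poly.span_base) auto

definition linear_map_kernel :: "'v set \<Rightarrow> ('v \<Rightarrow> 'w) \<Rightarrow> ('v, 'k::field) mpoly set" where
  "linear_map_kernel A \<phi> = {f \<in> linear_forms A. linear_map A \<phi> f = 0}"

definition is_basis_of :: "('v, 'k::field) mpoly set \<Rightarrow> ('v, 'k) mpoly set \<Rightarrow> bool" where
  "is_basis_of B V \<longleftrightarrow> poly.independent B \<and> poly.span B = V"


section \<open>Letterplace ideals\<close>

definition letterplace_ideal ::
    "nat \<Rightarrow> 'p::order set \<Rightarrow> (nat \<times> 'p, 'k::comm_ring_1) mpoly set" where
  "letterplace_ideal n P =
     Idl\<^bsub>poly_ring ({1..n} \<times> P)\<^esub>
       {\<Prod>i\<in>{1..n}. var (i, p i) | p. p \<in> {1..n} \<rightarrow> P \<and> mono_on {1..n} p}"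


section \<open>Left strict chain fibers\<close>

text \<open>The order on pairs is the componentwise one.\<close>

definition left_strict_chain :: "('q::order \<times> 'p::order) set \<Rightarrow> bool" where
  "left_strict_chain C \<longleftrightarrow>
     Complete_Partial_Order.chain (\<le>) C \<and>
     (\<forall>(q, p)\<in>C. \<forall>(q', p')\<in>C. (q, p) < (q', p') \<longrightarrow> q < q')"

text \<open>
  The opposite poset is given by the type \<open>'p dual\<close>; \<open>map_prod id dual\<close> is the identity
  from \<open>Q \<times> P\<close> to \<open>Q \<times> P\<^sup>o\<^sup>p\<close> on underlying sets.
\<close>

definition left_strict_chain_fibers ::
    "'q::order set \<Rightarrow> 'p::order set \<Rightarrow> 'r set \<Rightarrow> ('q \<times> 'p \<Rightarrow> 'r) \<Rightarrow> bool" where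
  "left_strict_chain_fibers Q P R \<phi> \<longleftrightarrow>
     (\<forall>r\<in>R. left_strict_chain (map_prod id dual ` {a \<in> Q \<times> P. \<phi> a = r}))"


section \<open>Regular sequences\<close>

text \<open>For commutative rings only; note that \<open>\<zero>\<close> is a nonzerodivisor of the zero ring.\<close>

definition nonzerodivisor :: "('a, 'b) ring_scheme \<Rightarrow> 'a \<Rightarrow> bool" where
  "nonzerodivisor A x \<longleftrightarrow>
     x \<in> carrier A \<and> (\<forall>y\<in>carrier A. x \<otimes>\<^bsub>A\<^esub> y = \<zero>\<^bsub>A\<^esub> \<longrightarrow> y = \<zero>\<^bsub>A\<^esub>)"

text \<open>
  No condition is put on the quotient by the whole sequence. For homogeneous elements of degree
  one in a nonzero graded quotient of a polynomial ring that quotient is automatically nonzero.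
\<close>

definition regular_sequence :: "('a, 'b) ring_scheme \<Rightarrow> 'a list \<Rightarrow> bool" where
  "regular_sequence A xs \<longleftrightarrow>
     set xs \<subseteq> carrier A \<and>
     (\<forall>i<length xs. let I = Idl\<^bsub>A\<^esub> (set (take i xs))
                    in nonzerodivisor (A Quot I) (I +>\<^bsub>A\<^esub> (xs ! i)))"

end

theory Submission
  imports Defs
begin

text \<open>
  The first \<open>i\<close> elements of \<open>B\<close> identify variables with each other, and each identification stays
  inside a fiber of \<open>\<phi>\<close>. Choose a representative \<open>\<psi> a\<close> in every class of identified variables.
  Substituting representatives turns \<open>k[x]/(L(n,P) + (b\<^sub>1, \<dots>, b\<^sub>i))\<close> into the quotient of a
  polynomial ring by the monomial ideal \<open>I\<close> generated by the images of the multichain monomials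
  (lemma \<open>in_genideal_monomials_Un_iff\<close>), and the next element of \<open>B\<close> into \<open>x - y\<close> for two
  variables \<open>x\<close>, \<open>y\<close>. They are different because \<open>B\<close> is linearly independent, and they stand for
  two classes inside one fiber of \<open>\<phi>\<close>.

  For a monomial ideal \<open>I\<close>, the element \<open>x - y\<close> is a nonzerodivisor modulo \<open>I\<close> as soon as
  \<open>xm \<in> I\<close> and \<open>ym \<in> I\<close> together imply \<open>m \<in> I\<close> for all monomials \<open>m\<close>
  (lemma \<open>keys_subset_if_keys_var_diff_mult_subset\<close>). This is where the hypotheses on \<open>\<phi>\<close> come in.
  If a multichain \<open>p\<close> shows \<open>xm \<in> I\<close> and a multichain \<open>q\<close> shows \<open>ym \<in> I\<close>, then, up to
  exchanging \<open>(x, p)\<close> and \<open>(y, q)\<close>, one of \<open>p\<close>, \<open>q\<close> and a multichain which follows \<open>q\<close> up to some place and then \<open>p\<close> shows \<open>m \<in> I\<close>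
  (lemma \<open>multichain_splice\<close>): in a left strict fiber the \<open>P\<close>-coordinate decreases weakly when the
  \<open>[n]\<close>-coordinate increases, whereas in a multichain it increases weakly, so that \<open>q\<close>, if its last
  visit to the fiber comes no earlier than that of \<open>p\<close>, lies below \<open>p\<close> at the last visit of \<open>p\<close>.

  Depending on which differences \<open>B\<close> consists of and on their order, the classes can be any pieces
  of fibers; this is why the splicing argument is carried out for an arbitrary map \<open>\<psi>\<close> through which
  \<open>\<phi>\<close> factors.
\<close>

section \<open>Regular sequences over quotient rings\<close>

lemma zero_FactRing: "\<zero>\<^bsub>A Quot I\<^esub> = I"
  by (simp add: FactRing_def)

lemma carrier_FactRing: "carrier (A Quot I) = (+>\<^bsub>A\<^esub>) I ` carrier A"
  by (auto simp: FactRing_simps)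

text \<open>
  The preimage of the ideal generated by the cosets of \<open>X\<close> is an ideal containing \<open>L\<close> and \<open>X\<close>;
  conversely the image of \<open>Idl (L \<union> X)\<close> is an ideal of the quotient, and reading off membership from
  the image loses nothing because \<open>L\<close> is contained in \<open>Idl (L \<union> X)\<close>.
\<close>

lemma (in cring) coset_in_genideal_quot_iff:
  assumes L: "ideal L R" and X: "X \<subseteq> carrier R" and h: "h \<in> carrier R"
  shows "L +> h \<in> Idl\<^bsub>R Quot L\<^esub> ((+>) L ` X) \<longleftrightarrow> h \<in> Idl (L \<union> X)"
proof -
  interpret L: ideal L R by (rule L)
  interpret Q: cring "R Quot L" by (rule L.quotient_is_cring) (rule cring_axioms)
  interpret pr: ring_hom_ring R "R Quot L" "(+>) L" by (rule L.rcos_ring_hom_ring)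
  have LX: "L \<union> X \<subseteq> carrier R" using X L.a_subset by blast
  have gens: "L \<union> X \<subseteq> Idl (L \<union> X)" by (rule genideal_self[OF LX])
  interpret K: ideal "Idl (L \<union> X)" R by (rule genideal_ideal[OF LX])
  have img: "(+>) L ` X \<subseteq> carrier (R Quot L)" using X pr.hom_closed by blast
  interpret J: ideal "Idl\<^bsub>R Quot L\<^esub> ((+>) L ` X)" "R Quot L" by (rule Q.genideal_ideal[OF img])
  show ?thesis
  proof
    assume "L +> h \<in> Idl\<^bsub>R Quot L\<^esub> ((+>) L ` X)"
    also have "\<dots> \<subseteq> (+>) L ` (Idl (L \<union> X))"
      using gens by (intro Q.genideal_minimal ring_ideal_imp_quot_ideal L K.is_ideal) blast
    finally obtain k where k: "k \<in> Idl (L \<union> X)" "L +> h = L +> k" by blast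
    then have "h \<ominus> k \<in> L"
      using quotient_eq_iff_same_a_r_cos[OF L h K.Icarr[OF k(1)]] by simp
    then have "h \<ominus> k \<oplus> k \<in> Idl (L \<union> X)" using gens k(1) by blast
    moreover have "h \<ominus> k \<oplus> k = h" using h K.Icarr[OF k(1)] by algebra
    ultimately show "h \<in> Idl (L \<union> X)" by simp
  next
    let ?V = "{r \<in> carrier R. L +> r \<in> Idl\<^bsub>R Quot L\<^esub> ((+>) L ` X)}"
    assume "h \<in> Idl (L \<union> X)"
    also have "\<dots> \<subseteq> ?V"
    proof (rule genideal_minimal)
      show "ideal ?V R" by (rule pr.ideal_vimage) (rule J.is_ideal)
      have "L +> l \<in> Idl\<^bsub>R Quot L\<^esub> ((+>) L ` X)" if "l \<in> L" for l
        using J.zero_closed unfolding a_rcos_zero[OF L that] zero_FactRing .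
      then show "L \<union> X \<subseteq> ?V"
        using LX Q.genideal_self[OF img] by blast
    qed
    finally show "L +> h \<in> Idl\<^bsub>R Quot L\<^esub> ((+>) L ` X)" by simp
  qed
qed

text \<open>
  Reduces regularity over the quotient by \<open>L\<close>, an assertion about iterated cosets, to membership
  in ideals of the original ring.
\<close>

lemma (in cring) regular_sequence_quotI:
  assumes L: "ideal L R" and bs: "set bs \<subseteq> carrier R"
    and nzd: "\<And>i f. \<lbrakk>i < length bs; f \<in> carrier R;
        bs ! i \<otimes> f \<in> Idl (L \<union> set (take i bs))\<rbrakk> \<Longrightarrow> f \<in> Idl (L \<union> set (take i bs))"
  shows "regular_sequence (R Quot L) (map (\<lambda>b. L +> b) bs)"
proof -
  interpret L: ideal L R by (rule L)
  interpret Q: cring "R Quot L" by (rule L.quotient_is_cring) (rule cring_axioms)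
  interpret pr: ring_hom_ring R "R Quot L" "(+>) L" by (rule L.rcos_ring_hom_ring)
  have "nonzerodivisor (R Quot L Quot J) (J +>\<^bsub>R Quot L\<^esub> (L +> bs ! i))"
    if i: "i < length bs" and J_def: "J = Idl\<^bsub>R Quot L\<^esub> ((+>) L ` set (take i bs))" for i J
  proof -
    have X: "set (take i bs) \<subseteq> carrier R" using bs set_take_subset[of i bs] by blast
    have b: "bs ! i \<in> carrier R" using bs i by auto
    have J_ideal: "ideal J (R Quot L)"
      unfolding J_def using X pr.hom_closed by (intro Q.genideal_ideal) blast
    interpret J: ideal J "R Quot L" by (rule J_ideal)
    interpret pr': ring_hom_ring "R Quot L" "R Quot L Quot J" "(+>\<^bsub>R Quot L\<^esub>) J"
      by (rule J.rcos_ring_hom_ring)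
    have J_iff: "J +>\<^bsub>R Quot L\<^esub> (L +> h) = J \<longleftrightarrow> h \<in> Idl (L \<union> set (take i bs))"
      if "h \<in> carrier R" for h
    proof -
      have "J +>\<^bsub>R Quot L\<^esub> (L +> h) = J \<longleftrightarrow> L +> h \<in> J"
        using J.rcos_const_imp_mem[OF pr.hom_closed[OF that]] Q.a_rcos_zero[OF J_ideal] by metis
      then show ?thesis
        by (simp only: J_def coset_in_genideal_quot_iff[OF L X that])
    qed
    show ?thesis
      unfolding nonzerodivisor_def zero_FactRing
    proof (intro conjI ballI impI)
      show "J +>\<^bsub>R Quot L\<^esub> (L +> bs ! i) \<in> carrier (R Quot L Quot J)"
        by (rule pr'.hom_closed[OF pr.hom_closed[OF b]])
      fix y assume y: "y \<in> carrier (R Quot L Quot J)"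
        and 0: "(J +>\<^bsub>R Quot L\<^esub> (L +> bs ! i)) \<otimes>\<^bsub>R Quot L Quot J\<^esub> y = J"
      from y obtain f where f: "f \<in> carrier R" "y = J +>\<^bsub>R Quot L\<^esub> (L +> f)"
        unfolding carrier_FactRing by blast
      have "J +>\<^bsub>R Quot L\<^esub> (L +> (bs ! i \<otimes> f)) = J"
        using 0 f(1) b
        by (simp only: f(2) pr.hom_mult pr'.hom_mult pr.hom_closed m_closed)
      then have "bs ! i \<otimes> f \<in> Idl (L \<union> set (take i bs))"
        using J_iff[OF m_closed[OF b f(1)]] by blast
      then show "y = J" using nzd[OF i f(1)] J_iff[OF f(1)] f(2) by blast
    qed
  qed
  moreover have "set (map ((+>) L) bs) \<subseteq> carrier (R Quot L)"
    using bs unfolding carrier_FactRing set_map by blast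
  ultimately show ?thesis
    unfolding regular_sequence_def Let_def by (auto simp: take_map)
qed

section \<open>Substituting representatives for variables\<close>

abbreviation monomial :: "('v \<Rightarrow>\<^sub>0 nat) \<Rightarrow> ('v, 'k::comm_ring_1) mpoly" where
  "monomial m \<equiv> Poly_Mapping.single m 1"

definition rename_exponent :: "('v \<Rightarrow> 'w) \<Rightarrow> ('v \<Rightarrow>\<^sub>0 nat) \<Rightarrow> ('w \<Rightarrow>\<^sub>0 nat)" where
  "rename_exponent \<psi> m =
     (\<Sum>a\<in>Poly_Mapping.keys m. Poly_Mapping.single (\<psi> a) (Poly_Mapping.lookup m a))"

definition rename_vars :: "('v \<Rightarrow> 'w) \<Rightarrow> ('v, 'k::comm_ring_1) mpoly \<Rightarrow> ('w, 'k) mpoly" where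
  "rename_vars \<psi> f =
     (\<Sum>m\<in>Poly_Mapping.keys f. Poly_Mapping.single (rename_exponent \<psi> m) (Poly_Mapping.lookup f m))"

lemma poly_mapping_eq_sum_single:
  "(\<Sum>a\<in>Poly_Mapping.keys f. Poly_Mapping.single a (Poly_Mapping.lookup f a)) = f"
proof (rule poly_mapping_eqI)
  fix k
  have "Poly_Mapping.lookup (\<Sum>a\<in>Poly_Mapping.keys f. Poly_Mapping.single a (Poly_Mapping.lookup f a)) k
      = (\<Sum>a\<in>Poly_Mapping.keys f. if a = k then Poly_Mapping.lookup f a else 0)"
    by (simp add: lookup_sum lookup_single when_def)
  then show "Poly_Mapping.lookup (\<Sum>a\<in>Poly_Mapping.keys f. Poly_Mapping.single a (Poly_Mapping.lookup f a)) k
      = Poly_Mapping.lookup f k"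
    by (simp add: in_keys_iff)
qed

lemma rename_exponent_0 [simp]: "rename_exponent \<psi> 0 = 0"
  by (simp add: rename_exponent_def)

lemma rename_exponent_add: "rename_exponent \<psi> (m + m') = rename_exponent \<psi> m + rename_exponent \<psi> m'"
  unfolding rename_exponent_def by (rule setsum_keys_plus_distrib) (simp_all add: single_add)

lemma rename_exponent_single: "rename_exponent \<psi> (Poly_Mapping.single a k) = Poly_Mapping.single (\<psi> a) k"
  by (cases "k = 0") (simp_all add: rename_exponent_def)

lemma rename_exponent_sum: "rename_exponent \<psi> (\<Sum>i\<in>I. m i) = (\<Sum>i\<in>I. rename_exponent \<psi> (m i))"
  by (induction I rule: infinite_finite_induct) (simp_all add: rename_exponent_add)

lemma keys_rename_exponent: "Poly_Mapping.keys (rename_exponent \<psi> m) \<subseteq> \<psi> ` Poly_Mapping.keys m"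
proof -
  have "Poly_Mapping.keys (rename_exponent \<psi> m)
      \<subseteq> (\<Union>a\<in>Poly_Mapping.keys m. Poly_Mapping.keys (Poly_Mapping.single (\<psi> a) (Poly_Mapping.lookup m a)))"
    unfolding rename_exponent_def by (rule keys_sum)
  also have "\<dots> \<subseteq> \<psi> ` Poly_Mapping.keys m" by (auto split: if_splits)
  finally show ?thesis .
qed

lemma rename_vars_0 [simp]: "rename_vars \<psi> 0 = 0"
  by (simp add: rename_vars_def)

lemma rename_vars_add: "rename_vars \<psi> (f + g) = rename_vars \<psi> f + rename_vars \<psi> g"
  unfolding rename_vars_def by (rule setsum_keys_plus_distrib) (simp_all add: single_add)

lemma rename_vars_diff: "rename_vars \<psi> (f - g) = rename_vars \<psi> f - rename_vars \<psi> g"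
  using rename_vars_add[of \<psi> "f - g" g] by simp

lemma rename_vars_single:
  "rename_vars \<psi> (Poly_Mapping.single m c) = Poly_Mapping.single (rename_exponent \<psi> m) c"
  by (cases "c = 0") (simp_all add: rename_vars_def)

lemma rename_vars_sum: "rename_vars \<psi> (\<Sum>i\<in>I. f i) = (\<Sum>i\<in>I. rename_vars \<psi> (f i))"
  by (induction I rule: infinite_finite_induct) (simp_all add: rename_vars_add)

lemma rename_vars_var: "rename_vars \<psi> (var a) = var (\<psi> a)"
  by (simp add: var_def rename_vars_single rename_exponent_single)

lemma rename_vars_mult: "rename_vars \<psi> (f * g) = rename_vars \<psi> f * rename_vars \<psi> g"
proof -
  let ?s = "\<lambda>f m. Poly_Mapping.single m (Poly_Mapping.lookup f m)"
  have "f * g = (\<Sum>m\<in>Poly_Mapping.keys f. ?s f m) * (\<Sum>m\<in>Poly_Mapping.keys g. ?s g m)"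
    by (simp only: poly_mapping_eq_sum_single)
  also have "\<dots> = (\<Sum>m\<in>Poly_Mapping.keys f. \<Sum>m'\<in>Poly_Mapping.keys g. ?s f m * ?s g m')"
    by (rule sum_product)
  finally have "rename_vars \<psi> (f * g) = (\<Sum>m\<in>Poly_Mapping.keys f. \<Sum>m'\<in>Poly_Mapping.keys g.
      rename_vars \<psi> (?s f m) * rename_vars \<psi> (?s g m'))"
    by (simp only: rename_vars_sum rename_vars_single mult_single rename_exponent_add)
  also have "\<dots> = rename_vars \<psi> f * rename_vars \<psi> g"
    unfolding rename_vars_single unfolding rename_vars_def sum_product ..
  finally show ?thesis .
qed

lemma rename_vars_in_poly_ring:
  assumes "\<psi> \<in> A \<rightarrow> B" "f \<in> carrier (poly_ring A)"
  shows "rename_vars \<psi> f \<in> carrier (poly_ring B)"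
proof -
  have "Poly_Mapping.keys (rename_vars \<psi> f)
      \<subseteq> (\<Union>m\<in>Poly_Mapping.keys f. Poly_Mapping.keys
          (Poly_Mapping.single (rename_exponent \<psi> m) (Poly_Mapping.lookup f m)))"
    unfolding rename_vars_def by (rule keys_sum)
  then have "Poly_Mapping.keys (rename_vars \<psi> f) \<subseteq> rename_exponent \<psi> ` Poly_Mapping.keys f"
    by (auto split: if_splits)
  then show ?thesis
    using assms keys_rename_exponent[of \<psi>] unfolding poly_ring_def by fastforce
qed

lemma poly_ring_simps:
  "\<one>\<^bsub>poly_ring A\<^esub> = 1" "\<zero>\<^bsub>poly_ring A\<^esub> = 0"
  "f \<otimes>\<^bsub>poly_ring A\<^esub> g = f * g" "f \<oplus>\<^bsub>poly_ring A\<^esub> g = f + g"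
  by (simp_all add: poly_ring_def)

lemma single_in_poly_ring: "Poly_Mapping.keys m \<subseteq> A \<Longrightarrow> Poly_Mapping.single m c \<in> carrier (poly_ring A)"
  by (simp add: poly_ring_def)

lemma diff_in_poly_ring:
  assumes "f \<in> carrier (poly_ring A)" "g \<in> carrier (poly_ring A)"
  shows "f - g \<in> carrier (poly_ring A)"
  using assms keys_diff[of f g] unfolding poly_ring_def by auto

lemma ideal_poly_ringI:
  fixes Z :: "('v, 'k::comm_ring_1) mpoly set"
  assumes Z: "Z \<subseteq> carrier (poly_ring A)" "0 \<in> Z"
    and add: "\<And>f g. \<lbrakk>f \<in> Z; g \<in> Z\<rbrakk> \<Longrightarrow> f + g \<in> Z"
    and mult: "\<And>f g. \<lbrakk>f \<in> carrier (poly_ring A); g \<in> Z\<rbrakk> \<Longrightarrow> f * g \<in> Z"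
  shows "ideal Z (poly_ring A)"
proof -
  interpret cring "poly_ring A :: ('v, 'k) mpoly ring" by (rule cring_poly_ring)
  have minus_one: "- 1 \<in> carrier (poly_ring A :: ('v, 'k) mpoly ring)"
    using single_in_poly_ring[of 0 A "- 1 :: 'k"] by (simp add: single_uminus)
  have minus: "- f \<in> Z" if "f \<in> Z" for f using mult[OF minus_one that] by simp
  have inv: "\<ominus>\<^bsub>poly_ring A\<^esub> f = - f" if "f \<in> Z" for f
    using that minus[OF that] Z(1) by (intro minus_equality) (auto simp: poly_ring_simps)
  show ?thesis
  proof (rule idealI)
    show "ring (poly_ring A :: ('v, 'k) mpoly ring)" by (rule ring_axioms)
    show "subgroup Z (add_monoid (poly_ring A))"
    proof (rule add.subgroupI)
      show "\<ominus>\<^bsub>poly_ring A\<^esub> f \<in> Z" if "f \<in> Z" for f using inv minus that by simp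
    qed (use Z add in \<open>auto simp: poly_ring_simps\<close>)
    fix f g :: "('v, 'k) mpoly" assume "f \<in> Z" "g \<in> carrier (poly_ring A)"
    then have "g * f \<in> Z" by (intro mult)
    then show "g \<otimes>\<^bsub>poly_ring A\<^esub> f \<in> Z" "f \<otimes>\<^bsub>poly_ring A\<^esub> g \<in> Z"
      by (simp_all only: poly_ring_simps mult.commute[of f g])
  qed
qed

lemma ideal_poly_ringD:
  fixes K :: "('v, 'k::comm_ring_1) mpoly set"
  assumes "ideal K (poly_ring A)"
  shows "0 \<in> K" "\<And>f g. \<lbrakk>f \<in> K; g \<in> K\<rbrakk> \<Longrightarrow> f + g \<in> K"
    "\<And>f g. \<lbrakk>f \<in> carrier (poly_ring A); g \<in> K\<rbrakk> \<Longrightarrow> f * g \<in> K"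
proof -
  note subgroup = ideal.axioms(1)[OF assms]
  show "0 \<in> K" "\<And>f g. \<lbrakk>f \<in> K; g \<in> K\<rbrakk> \<Longrightarrow> f + g \<in> K"
    "\<And>f g. \<lbrakk>f \<in> carrier (poly_ring A); g \<in> K\<rbrakk> \<Longrightarrow> f * g \<in> K"
    using additive_subgroup.zero_closed[OF subgroup] additive_subgroup.a_closed[OF subgroup]
      ideal.I_l_closed[OF assms] unfolding poly_ring_simps by blast+
qed

lemma ideal_poly_ring_sum:
  assumes "ideal K (poly_ring A)" "\<And>i. i \<in> I \<Longrightarrow> f i \<in> K"
  shows "(\<Sum>i\<in>I. f i) \<in> K"
  using assms(2) by (induction I rule: infinite_finite_induct)
    (auto intro: ideal_poly_ringD[OF assms(1)])

text \<open>
  Modulo \<open>K\<close> a variable may be replaced by its representative, one factor at a time: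
  \<open>mm' - \<psi>(m)\<psi>(m') = m(m' - \<psi>(m')) + \<psi>(m')(m - \<psi>(m))\<close>.
\<close>

lemma monomial_diff_rename_in_ideal:
  fixes K :: "('v, 'k::comm_ring_1) mpoly set"
  assumes K: "ideal K (poly_ring A)" and \<psi>: "\<psi> \<in> A \<rightarrow> A"
    and var_diff: "\<And>a. a \<in> A \<Longrightarrow> var a - var (\<psi> a) \<in> K"
    and m: "Poly_Mapping.keys m \<subseteq> A"
  shows "monomial m - monomial (rename_exponent \<psi> m) \<in> K"
proof -
  let ?D = "\<lambda>m. monomial m - monomial (rename_exponent \<psi> m) :: ('v, 'k) mpoly"
  note K_closed = ideal_poly_ringD[OF K]
  have D_add: "?D (m + m') \<in> K"
    if "?D m \<in> K" "?D m' \<in> K" "Poly_Mapping.keys m \<subseteq> A" "Poly_Mapping.keys m' \<subseteq> A" for m m'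
  proof -
    have "Poly_Mapping.keys (rename_exponent \<psi> m') \<subseteq> A"
      using keys_rename_exponent[of \<psi> m'] \<psi> that(4) by fastforce
    then have "monomial m * ?D m' + monomial (rename_exponent \<psi> m') * ?D m \<in> K"
      using that by (intro K_closed single_in_poly_ring)
    also have "monomial m * ?D m' + monomial (rename_exponent \<psi> m') * ?D m = ?D (m + m')"
      by (simp add: right_diff_distrib mult_single rename_exponent_add add.commute)
    finally show ?thesis .
  qed
  have D_single: "?D (Poly_Mapping.single a k) \<in> K" if "a \<in> A" for a k
  proof (induction k)
    case 0
    show ?case using K_closed(1) by simp
  next
    case (Suc k)
    have "?D (Poly_Mapping.single a 1) \<in> K"
      using var_diff[OF that] by (simp add: var_def rename_exponent_single)
    then have "?D (Poly_Mapping.single a 1 + Poly_Mapping.single a k) \<in> K"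
      using that Suc.IH by (intro D_add) auto
    then show ?case by (simp flip: single_add)
  qed
  have "?D (\<Sum>a\<in>I. Poly_Mapping.single a (Poly_Mapping.lookup m a)) \<in> K
      \<and> Poly_Mapping.keys (\<Sum>a\<in>I. Poly_Mapping.single a (Poly_Mapping.lookup m a)) \<subseteq> A"
    if "finite I" "I \<subseteq> A" for I
    using that
  proof (induction I rule: finite_induct)
    case empty
    show ?case using K_closed(1) by simp
  next
    case (insert a I)
    let ?s = "\<Sum>a\<in>I. Poly_Mapping.single a (Poly_Mapping.lookup m a)"
    have IH: "?D ?s \<in> K" "Poly_Mapping.keys ?s \<subseteq> A" using insert by auto
    have a: "a \<in> A" "Poly_Mapping.keys (Poly_Mapping.single a (Poly_Mapping.lookup m a)) \<subseteq> A"
      using insert.prems by auto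
    have "?D (Poly_Mapping.single a (Poly_Mapping.lookup m a) + ?s) \<in> K"
      by (intro D_add D_single a IH)
    moreover have "Poly_Mapping.keys (Poly_Mapping.single a (Poly_Mapping.lookup m a) + ?s) \<subseteq> A"
      using keys_add[of "Poly_Mapping.single a (Poly_Mapping.lookup m a)" ?s] a(2) IH(2) by blast
    ultimately show ?case using insert.hyps by simp
  qed
  from this[of "Poly_Mapping.keys m"] m show ?thesis
    by (simp add: poly_mapping_eq_sum_single)
qed

lemma diff_rename_vars_in_ideal:
  fixes K :: "('v, 'k::comm_ring_1) mpoly set"
  assumes K: "ideal K (poly_ring A)" and \<psi>: "\<psi> \<in> A \<rightarrow> A"
    and var_diff: "\<And>a. a \<in> A \<Longrightarrow> var a - var (\<psi> a) \<in> K"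
    and f: "f \<in> carrier (poly_ring A)"
  shows "f - rename_vars \<psi> f \<in> K"
proof -
  let ?c = "Poly_Mapping.lookup f"
  have "f - rename_vars \<psi> f = (\<Sum>m\<in>Poly_Mapping.keys f. Poly_Mapping.single m (?c m))
      - (\<Sum>m\<in>Poly_Mapping.keys f. Poly_Mapping.single (rename_exponent \<psi> m) (?c m))"
    by (simp only: rename_vars_def poly_mapping_eq_sum_single)
  also have "\<dots> = (\<Sum>m\<in>Poly_Mapping.keys f.
      Poly_Mapping.single 0 (?c m) * (monomial m - monomial (rename_exponent \<psi> m)))"
    by (simp add: sum_subtractf right_diff_distrib mult_single)
  also have "\<dots> \<in> K"
    using f by (intro ideal_poly_ring_sum[OF K] ideal_poly_ringD(3)[OF K] single_in_poly_ring
        monomial_diff_rename_in_ideal[OF K \<psi> var_diff]) (auto simp: poly_ring_def)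
  finally show ?thesis .
qed

text \<open>
  If every variable agrees with its representative modulo \<open>K\<close>, then every polynomial agrees with its
  renaming modulo \<open>K\<close>. As renaming kills \<open>X\<close>, the ideal \<open>K\<close> is the preimage under renaming of the
  ideal generated by the renamed monomials of \<open>S\<close>, and membership in a monomial ideal is a condition
  on each monomial separately: it has to be a multiple of a generator.
\<close>

lemma in_genideal_monomials_Un_iff:
  fixes A :: "'v set" and S :: "('v \<Rightarrow>\<^sub>0 nat) set" and X :: "('v, 'k::comm_ring_1) mpoly set"
  defines "K \<equiv> Idl\<^bsub>poly_ring A\<^esub> (Idl\<^bsub>poly_ring A\<^esub> (monomial ` S) \<union> X)"
  assumes \<psi>: "\<psi> \<in> A \<rightarrow> A" and S: "\<And>g. g \<in> S \<Longrightarrow> Poly_Mapping.keys g \<subseteq> A"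
    and X: "X \<subseteq> carrier (poly_ring A)" "\<And>b. b \<in> X \<Longrightarrow> rename_vars \<psi> b = 0"
    and var_diff: "\<And>a. a \<in> A \<Longrightarrow> var a - var (\<psi> a) \<in> K"
    and f: "f \<in> carrier (poly_ring A)"
  shows "f \<in> K \<longleftrightarrow> Poly_Mapping.keys (rename_vars \<psi> f) \<subseteq> {u + rename_exponent \<psi> g | u g. g \<in> S}"
proof -
  interpret cring "poly_ring A :: ('v, 'k) mpoly ring" by (rule cring_poly_ring)
  define M where "M = {u + rename_exponent \<psi> g | u g. g \<in> S}"
  have M_up: "u + m \<in> M" if "m \<in> M" for u m
  proof -
    from that obtain v g where "g \<in> S" "m = v + rename_exponent \<psi> g" by (auto simp: M_def)
    then show ?thesis unfolding M_def by (intro CollectI exI[of _ "u + v"] exI[of _ g]) (simp add: add.assoc)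
  qed
  have gens: "monomial ` S \<subseteq> carrier (poly_ring A :: ('v, 'k) mpoly ring)"
    by (intro image_subsetI single_in_poly_ring S)
  have L: "ideal (Idl\<^bsub>poly_ring A\<^esub> (monomial ` S)) (poly_ring A :: ('v, 'k) mpoly ring)"
    by (rule genideal_ideal[OF gens])
  have LX: "Idl\<^bsub>poly_ring A\<^esub> (monomial ` S) \<union> X \<subseteq> carrier (poly_ring A)"
    using ideal.Icarr[OF L] X(1) by blast
  have K: "ideal K (poly_ring A)" unfolding K_def by (rule genideal_ideal[OF LX])
  note K_closed = ideal_poly_ringD[OF K]
  have gens_K: "monomial g \<in> K" if "g \<in> S" for g
    using genideal_self[OF gens] genideal_self[OF LX] that unfolding K_def by blast
  have "f \<in> K \<longleftrightarrow> Poly_Mapping.keys (rename_vars \<psi> f) \<subseteq> M"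
  proof
    let ?Z = "{f \<in> carrier (poly_ring A). Poly_Mapping.keys (rename_vars \<psi> f) \<subseteq> M}
      :: ('v, 'k) mpoly set"
    have Z: "ideal ?Z (poly_ring A)"
    proof (rule ideal_poly_ringI)
      show "?Z \<subseteq> carrier (poly_ring A)" by blast
      show "0 \<in> ?Z" using zero_closed by (simp add: poly_ring_simps)
      show "f + g \<in> ?Z" if "f \<in> ?Z" "g \<in> ?Z" for f g
        using that a_closed[of f g] keys_add[of "rename_vars \<psi> f" "rename_vars \<psi> g"]
        by (auto simp: poly_ring_simps rename_vars_add)
      show "f * g \<in> ?Z" if "f \<in> carrier (poly_ring A)" "g \<in> ?Z" for f g
      proof -
        have "Poly_Mapping.keys (rename_vars \<psi> f * rename_vars \<psi> g) \<subseteq> M"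
          using keys_mult[of "rename_vars \<psi> f" "rename_vars \<psi> g"] that(2) M_up by blast
        then show ?thesis
          using m_closed[of f g] that by (simp add: poly_ring_simps rename_vars_mult)
      qed
    qed
    have "monomial g \<in> ?Z" if g: "g \<in> S" for g
    proof -
      have "0 + rename_exponent \<psi> g \<in> M" unfolding M_def using g by blast
      then show ?thesis using single_in_poly_ring[OF S[OF g]] by (simp add: rename_vars_single)
    qed
    then have "Idl\<^bsub>poly_ring A\<^esub> (monomial ` S) \<subseteq> ?Z" by (intro genideal_minimal[OF Z]) blast
    moreover have "X \<subseteq> ?Z" using X by auto
    ultimately have "K \<subseteq> ?Z" unfolding K_def by (intro genideal_minimal[OF Z]) blast
    then show "Poly_Mapping.keys (rename_vars \<psi> f) \<subseteq> M" if "f \<in> K" using that by blast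
  next
    assume keys: "Poly_Mapping.keys (rename_vars \<psi> f) \<subseteq> M"
    have "Poly_Mapping.single m c \<in> K"
      if m: "m \<in> Poly_Mapping.keys (rename_vars \<psi> f)" for m c
    proof -
      obtain u g where ug: "g \<in> S" "m = u + rename_exponent \<psi> g"
        using keys m unfolding M_def by blast
      have "Poly_Mapping.keys m \<subseteq> A"
        using rename_vars_in_poly_ring[OF \<psi> f] m unfolding poly_ring_def by simp
      moreover have "Poly_Mapping.keys u \<subseteq> Poly_Mapping.keys m"
        unfolding ug(2) by (auto simp: in_keys_iff lookup_add)
      ultimately have u: "Poly_Mapping.single u k \<in> carrier (poly_ring A)" for k :: 'k
        by (intro single_in_poly_ring) blast
      \<comment> \<open>a multiple of the original generator, corrected by the change that renaming makes to it\<close>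
      have "Poly_Mapping.single u c * monomial g
          + Poly_Mapping.single u (- c) * (monomial g - monomial (rename_exponent \<psi> g)) \<in> K"
        by (intro K_closed u gens_K ug(1) monomial_diff_rename_in_ideal[OF K \<psi> var_diff] S)
      then show ?thesis
        by (simp add: ug(2) mult_single right_diff_distrib single_uminus)
    qed
    then have "(\<Sum>m\<in>Poly_Mapping.keys (rename_vars \<psi> f).
        Poly_Mapping.single m (Poly_Mapping.lookup (rename_vars \<psi> f) m)) \<in> K"
      by (rule ideal_poly_ring_sum[OF K])
    then have "rename_vars \<psi> f \<in> K" by (simp only: poly_mapping_eq_sum_single)
    moreover have "f - rename_vars \<psi> f \<in> K"
      by (rule diff_rename_vars_in_ideal[OF K \<psi> var_diff f])
    ultimately have "(f - rename_vars \<psi> f) + rename_vars \<psi> f \<in> K" by (intro K_closed)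
    then show "f \<in> K" by simp
  qed
  then show ?thesis by (simp only: M_def)
qed

section \<open>Differences of variables modulo monomial ideals\<close>

lemma lookup_var_mult_shift: "Poly_Mapping.lookup (var x * f) (Poly_Mapping.single x 1 + m) = Poly_Mapping.lookup f m"
  by (simp add: lookup_mult var_def lookup_single when_mult)

lemma lookup_var_mult_0: 
  "Poly_Mapping.lookup k x = 0 \<Longrightarrow> Poly_Mapping.lookup (var x * f) k = 0"
proof -
  assume "Poly_Mapping.lookup k x = 0"
  then have "k \<noteq> Poly_Mapping.single x 1 + q" for q
    by (auto simp: lookup_add)
  then show ?thesis by (simp add: lookup_mult var_def lookup_single when_mult)
qed

abbreviation "expo x \<equiv> Poly_Mapping.single x (1::nat)"

text \<open>
  The coefficient of \<open>(x - y)f\<close> at a monomial \<open>ym\<close> is the coefficient of \<open>f\<close> at \<open>ym/x\<close> minus the one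
  at \<open>m\<close>. It vanishes if \<open>ym\<close> is outside \<open>M\<close>, so that a monomial of \<open>f\<close> can be traded for one with
  an \<open>x\<close> replaced by a \<open>y\<close>.
\<close>

lemma key_shift_outside:
  fixes f :: "('v, 'k::comm_ring_1) mpoly"
  assumes xy: "x \<noteq> y" and prod: "Poly_Mapping.keys ((var x - var y) * f) \<subseteq> M"
    and m: "m \<in> Poly_Mapping.keys f" "expo y + m \<notin> M"
  obtains m' where "m = expo x + m'" "expo y + m' \<in> Poly_Mapping.keys f"
proof -
  have "Poly_Mapping.lookup ((var x - var y) * f) (expo y + m) = 0"
    using prod m(2) by (auto simp: in_keys_iff)
  then have eq: "Poly_Mapping.lookup (var x * f) (expo y + m) = Poly_Mapping.lookup f m"
    using lookup_var_mult_shift[of y f m] by (simp add: left_diff_distrib lookup_minus)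
  then have "Poly_Mapping.lookup (expo y + m) x \<noteq> 0"
    using lookup_var_mult_0[of "expo y + m" x f] m(1) by (metis in_keys_iff)
  then have pos: "Poly_Mapping.lookup m x \<ge> 1"
    using xy by (simp add: lookup_add lookup_single)
  define m' where "m' = m - expo x"
  have mm': "m = expo x + m'"
    using pos unfolding m'_def
    by (intro poly_mapping_eqI) (auto simp: lookup_add lookup_minus lookup_single when_def)
  have "Poly_Mapping.lookup f (expo y + m') = Poly_Mapping.lookup f m"
    using eq lookup_var_mult_shift[of x f "expo y + m'"] by (simp add: mm' ac_simps)
  then show ?thesis using that mm' m(1) by (simp add: in_keys_iff)
qed

text \<open>
  Read \<open>M\<close> as the set of monomials of a monomial ideal; the lemma says that \<open>x - y\<close> is a
  nonzerodivisor modulo it. Trading \<open>x\<close> for \<open>y\<close> must end, as the exponent of \<open>x\<close> decreases, so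
  every monomial of \<open>f\<close> enters \<open>M\<close> after multiplication by a power of \<open>y\<close>. Trading \<open>y\<close> for \<open>x\<close>
  outside \<open>M\<close> must end as well, namely at a monomial \<open>m\<close> of \<open>f\<close> outside \<open>M\<close> with \<open>xm \<in> M\<close>. Then
  \<open>xy\<^sup>tm \<in> M\<close> for all \<open>t\<close>, and the hypothesis \<open>colon\<close> lowers the power of \<open>y\<close> until \<open>m \<in> M\<close>.
\<close>

lemma keys_subset_if_keys_var_diff_mult_subset:
  fixes f :: "('v, 'k::comm_ring_1) mpoly"
  assumes up: "\<And>m u. m \<in> M \<Longrightarrow> u + m \<in> M"
    and colon: "\<And>m. \<lbrakk>expo x + m \<in> M; expo y + m \<in> M\<rbrakk> \<Longrightarrow> m \<in> M"
    and xy: "x \<noteq> y" and prod: "Poly_Mapping.keys ((var x - var y) * f) \<subseteq> M"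
  shows "Poly_Mapping.keys f \<subseteq> M"
proof (rule ccontr)
  have "(var y - var x) * f = - ((var x - var y) * f)"
    by (simp only: minus_diff_eq flip: mult_minus_left)
  then have prod': "Poly_Mapping.keys ((var y - var x) * f) \<subseteq> M"
    using prod by (auto simp: in_keys_iff)
  have y_Suc: "Poly_Mapping.single y (Suc t) = expo y + Poly_Mapping.single y t" for t
    using single_add[of y 1 t] by simp
  have y_power: "\<exists>t. Poly_Mapping.single y t + m \<in> M" if "m \<in> Poly_Mapping.keys f" for m
    using that
  proof (induction "Poly_Mapping.lookup m x" arbitrary: m rule: less_induct)
    case less
    show ?case
    proof (cases "expo y + m \<in> M")
      case False
      obtain m' where m': "m = expo x + m'" "expo y + m' \<in> Poly_Mapping.keys f"
        by (rule key_shift_outside[OF xy prod less.prems False])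
      then obtain t where "Poly_Mapping.single y t + (expo y + m') \<in> M"
        using less.hyps[of "expo y + m'"] xy by (auto simp: lookup_add lookup_single)
      from up[OF this, of "expo x"] show ?thesis
        by (intro exI[of _ "Suc t"]) (simp only: m'(1) y_Suc ac_simps)
    qed blast
  qed
  have x_boundary: "\<exists>m'\<in>Poly_Mapping.keys f. m' \<notin> M \<and> expo x + m' \<in> M"
    if "m \<in> Poly_Mapping.keys f" "m \<notin> M" for m
    using that
  proof (induction "Poly_Mapping.lookup m y" arbitrary: m rule: less_induct)
    case less
    show ?case
    proof (cases "expo x + m \<in> M")
      case False
      obtain m' where m': "m = expo y + m'" "expo x + m' \<in> Poly_Mapping.keys f"
        by (rule key_shift_outside[OF xy[symmetric] prod' less.prems(1) False])
      moreover have "expo x + m' \<notin> M"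
        using up[of "expo x + m'" "expo y"] False by (auto simp: m'(1) ac_simps)
      ultimately show ?thesis
        using less.hyps[of "expo x + m'"] xy by (auto simp: lookup_add lookup_single)
    qed (use less.prems in blast)
  qed
  assume "\<not> Poly_Mapping.keys f \<subseteq> M"
  then obtain m where m: "m \<in> Poly_Mapping.keys f" "m \<notin> M" "expo x + m \<in> M"
    using x_boundary by blast
  obtain t where "Poly_Mapping.single y t + m \<in> M" using y_power[OF m(1)] by blast
  then have "m \<in> M"
  proof (induction t)
    case (Suc t)
    have "expo y + (Poly_Mapping.single y t + m) \<in> M"
      using Suc.prems by (simp only: y_Suc ac_simps)
    moreover have "expo x + (Poly_Mapping.single y t + m) \<in> M"
      using up[OF m(3), of "Poly_Mapping.single y t"] by (simp add: ac_simps)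
    ultimately show ?case using Suc.IH colon by blast
  qed simp
  with m(2) show False ..
qed

section \<open>Splicing multichains\<close>

text \<open>
  After renaming by \<open>\<psi>\<close>, this is the exponent of the variable \<open>c\<close> in the monomial of the multichain
  \<open>p\<close>.
\<close>

definition word_count :: "nat \<Rightarrow> (nat \<times> 'p \<Rightarrow> 'c) \<Rightarrow> (nat \<Rightarrow> 'p) \<Rightarrow> 'c \<Rightarrow> nat" where
  "word_count n \<psi> p c = card {l \<in> {1..n}. \<psi> (l, p l) = c}"

lemma word_count_le:
  assumes "\<And>l. \<lbrakk>l \<in> {1..n}; \<psi> (l, p l) = c\<rbrakk> \<Longrightarrow> \<psi> (l, q l) = c"
  shows "word_count n \<psi> p c \<le> word_count n \<psi> q c"
  unfolding word_count_def by (rule card_mono) (use assms in auto)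

definition multichains :: "nat \<Rightarrow> 'p::order set \<Rightarrow> (nat \<Rightarrow> 'p) set" where
  "multichains n P = {p. p \<in> {1..n} \<rightarrow> P \<and> mono_on {1..n} p}"

text \<open>
  The case \<open>l = l'\<close> is left strictness: a fiber has at most one element over each \<open>l\<close>.
\<close>

lemma left_strict_chain_fibers_antimono:
  fixes \<phi> :: "nat \<times> 'p::order \<Rightarrow> 'r"
  assumes "left_strict_chain_fibers {1..n} P R \<phi>" "\<phi> \<in> {1..n} \<times> P \<rightarrow> R"
    and "l \<in> {1..n}" "l' \<in> {1..n}" "p \<in> P" "p' \<in> P" "\<phi> (l, p) = \<phi> (l', p')" "l \<le> l'"
  shows "p' \<le> p"
proof (rule ccontr)
  assume not: "\<not> p' \<le> p"
  let ?C = "map_prod id dual ` {a \<in> {1..n} \<times> P. \<phi> a = \<phi> (l, p)}"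
  have "left_strict_chain ?C"
    using assms unfolding left_strict_chain_fibers_def by blast
  moreover have "(l, dual p) \<in> ?C" "(l', dual p') \<in> ?C" using assms by force+
  ultimately have "(l, dual p) \<le> (l', dual p') \<or> (l', dual p') \<le> (l, dual p)"
      "(l', dual p') < (l, dual p) \<longrightarrow> l' < l"
    unfolding left_strict_chain_def Complete_Partial_Order.chain_def by blast+
  then show False using not \<open>l \<le> l'\<close> by (auto simp: less_le)
qed

text \<open>
  Here \<open>\<psi>\<close> assigns to each variable its class, \<open>\<theta>\<close> to each class its fiber, \<open>s\<close> is the fiber
  containing the classes \<open>x\<close> and \<open>y\<close>, \<open>m\<close> is the exponent of a monomial, and \<open>p\<close> and \<open>q\<close> fit
  into \<open>xm\<close> and \<open>ym\<close>. The assumptions single out the last visit \<open>b\<close> of \<open>p\<close> to the fiber and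
  require a visit \<open>b'\<close> of \<open>q\<close> that is not earlier, whence \<open>q b' \<le> p b\<close>.

  If \<open>q\<close> meets \<open>y\<close> after \<open>b\<close>, the multichain \<open>w\<close> which follows \<open>q\<close> up to \<open>b\<close> and \<open>p\<close> afterwards
  fits into \<open>m\<close>. It loses a visit to \<open>y\<close>, it has no visit to \<open>x\<close> from \<open>p\<close>, and no class
  is visited in both parts: such a class would force \<open>q\<close> and \<open>p\<close> to be constant between the two
  visits, and its fiber would be \<open>s\<close> by isotonicity, which \<open>p\<close> no longer meets.

  Otherwise all visits of \<open>q\<close> to \<open>y\<close> are at most \<open>b\<close>. If \<open>p\<close> agrees with \<open>q\<close> at all of them, then
  \<open>q\<close> meets \<open>y\<close> no more often than \<open>p\<close> and fits into \<open>m\<close>. If they differ at some visit \<open>j\<close>, then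
  \<open>q\<close> has the constant value \<open>p b\<close> from \<open>j\<close> to \<open>b'\<close>, while all visits of \<open>p\<close> to the fiber
  come after \<open>j\<close>; so \<open>p\<close> agrees with \<open>q\<close> at them, meets \<open>x\<close> no more often than \<open>q\<close> and fits into \<open>m\<close>.
\<close>

lemma multichain_splice_ordered:
  fixes \<phi> :: "nat \<times> 'p::order \<Rightarrow> 'r::order" and \<psi> :: "nat \<times> 'p \<Rightarrow> 'c" and m :: "'c \<Rightarrow> nat"
  assumes mono: "mono_on ({1..n} \<times> P) \<phi>"
    and anti: "\<And>l l' p p'. \<lbrakk>l \<in> {1..n}; l' \<in> {1..n}; p \<in> P; p' \<in> P;
        \<phi> (l, p) = \<phi> (l', p'); l \<le> l'\<rbrakk> \<Longrightarrow> p' \<le> p"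
    and refine: "\<And>a. a \<in> {1..n} \<times> P \<Longrightarrow> \<theta> (\<psi> a) = \<phi> a"
    and xy: "x \<noteq> y" "\<theta> x = s" "\<theta> y = s"
    and p: "p \<in> multichains n P"
    and px': "\<And>c. word_count n \<psi> p c \<le> m c + (if c = x then 1 else 0)"
    and q: "q \<in> multichains n P"
    and qy': "\<And>c. word_count n \<psi> q c \<le> m c + (if c = y then 1 else 0)"
    and b: "b \<in> {1..n}" "\<phi> (b, p b) = s" "\<And>l. \<lbrakk>l \<in> {1..n}; b < l\<rbrakk> \<Longrightarrow> \<phi> (l, p l) \<noteq> s"
    and b': "b' \<in> {1..n}" "\<phi> (b', q b') = s" "b \<le> b'"
  shows "\<exists>w \<in> multichains n P. \<forall>c. word_count n \<psi> w c \<le> m c"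
proof -
  have px: "word_count n \<psi> p c \<le> m c" if "c \<noteq> x" for c using px'[of c] that by simp
  have qy: "word_count n \<psi> q c \<le> m c" if "c \<noteq> y" for c using qy'[of c] that by simp
  have qy1: "word_count n \<psi> q y \<le> m y + 1" using qy'[of y] by simp
  have pP: "p l \<in> P" and qP: "q l \<in> P" if "l \<in> {1..n}" for l
    using p q that by (auto simp: multichains_def)
  have p_mono: "p l \<le> p l'" and q_mono: "q l \<le> q l'"
    if "l \<in> {1..n}" "l' \<in> {1..n}" "l \<le> l'" for l l'
    using p q that by (auto simp: multichains_def mono_on_def)
  have row: "\<phi> (l, c) \<le> \<phi> (l', c)" if "l \<in> {1..n}" "l' \<in> {1..n}" "l \<le> l'" "c \<in> P" for l l' c
    using mono that by (intro mono_onD[OF mono]) auto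
  have qp: "q b' \<le> p b" using anti[OF b(1) b'(1) pP[OF b(1)] qP[OF b'(1)]] b b' by simp
  show ?thesis
  proof (cases "\<exists>l\<in>{1..n}. b < l \<and> \<psi> (l, q l) = y")
    case True
    then obtain k where k: "k \<in> {1..n}" "b < k" "\<psi> (k, q k) = y" by blast
    define w where "w l = (if l \<le> b then q l else p l)" for l
    have "w l \<le> w l'" if l: "l \<in> {1..n}" "l' \<in> {1..n}" "l \<le> l'" for l l'
    proof (cases "l \<le> b \<and> b < l'")
      case True
      then have "q l \<le> q b'" using l b' by (intro q_mono) auto
      also have "\<dots> \<le> p b" by (rule qp)
      also have "\<dots> \<le> p l'" using True l b by (intro p_mono) auto
      finally show ?thesis using True by (simp add: w_def)
    qed (use l p_mono q_mono in \<open>auto simp: w_def\<close>)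
    then have "w \<in> multichains n P"
      using pP qP by (auto simp: multichains_def mono_on_def w_def)
    moreover have "word_count n \<psi> w c \<le> m c" for c
    proof (cases "\<exists>l'\<in>{1..n}. b < l' \<and> \<psi> (l', p l') = c")
      case True
      then obtain l' where l': "l' \<in> {1..n}" "b < l'" "\<psi> (l', p l') = c" by blast
      have c': "\<theta> c = \<phi> (l', p l')" using refine[of "(l', p l')"] l' pP by auto
      have "\<psi> (l, q l) \<noteq> c" if l: "l \<in> {1..n}" "l \<le> b" for l
      proof
        assume "\<psi> (l, q l) = c"
        then have eq: "\<phi> (l, q l) = \<phi> (l', p l')"
          using refine[of "(l, q l)"] l qP c' by auto
        have "p l' \<le> q l" using anti[OF l(1) l'(1) qP[OF l(1)] pP[OF l'(1)] eq] l l' by simp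
        moreover have "q l \<le> q b'" using l b' by (intro q_mono) auto
        moreover have "p b \<le> p l'" using l' b by (intro p_mono) auto
        ultimately have const: "q l = p b" "p l' = p b" using qp by auto
        have "\<phi> (l, p b) \<le> \<phi> (b, p b)" "\<phi> (b, p b) \<le> \<phi> (l', p b)"
          using l l' b pP by (auto intro!: row)
        then have "\<phi> (l', p l') = s" using eq const b(2) by simp
        then show False using b(3) l' by blast
      qed
      then have "word_count n \<psi> w c \<le> word_count n \<psi> p c"
        by (intro word_count_le) (auto simp: w_def split: if_splits)
      moreover have "c \<noteq> x" using b(3)[OF l'(1,2)] c' xy(2) by metis
      ultimately show ?thesis using px[of c] by simp
    next
      case False
      then have sub: "{l \<in> {1..n}. \<psi> (l, w l) = c} \<subseteq> {l \<in> {1..n}. \<psi> (l, q l) = c \<and> l \<le> b}"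
      proof (intro subsetI CollectI)
        fix l assume l: "l \<in> {l \<in> {1..n}. \<psi> (l, w l) = c}"
        then have "l \<le> b" using False by (cases "l \<le> b") (auto simp only: w_def mem_Collect_eq if_False not_le)
        then show "l \<in> {1..n} \<and> \<psi> (l, q l) = c \<and> l \<le> b" using l by (auto simp: w_def)
      qed
      show ?thesis
      proof (cases "c = y")
        case True
        have "k \<in> {l \<in> {1..n}. \<psi> (l, q l) = c} - {l \<in> {1..n}. \<psi> (l, w l) = c}"
          using sub k True by fastforce
        then have "{l \<in> {1..n}. \<psi> (l, w l) = c} \<subset> {l \<in> {1..n}. \<psi> (l, q l) = c}"
          using sub by blast
        then have "word_count n \<psi> w c < word_count n \<psi> q c"
          unfolding word_count_def by (intro psubset_card_mono) auto
        then show ?thesis using qy1 True by simp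
      next
        case False
        have "word_count n \<psi> w c \<le> word_count n \<psi> q c"
          unfolding word_count_def using sub by (intro card_mono) auto
        then show ?thesis using qy[OF False] by simp
      qed
    qed
    ultimately show ?thesis by blast
  next
    case no_late: False
    show ?thesis
    proof (cases "\<forall>l\<in>{1..n}. \<psi> (l, q l) = y \<longrightarrow> p l = q l")
      case True
      then have "word_count n \<psi> q y \<le> word_count n \<psi> p y"
        by (intro word_count_le) auto
      then have "word_count n \<psi> q c \<le> m c" for c
        using px[of y] qy[of c] xy(1) by (cases "c = y") auto
      then show ?thesis using q by blast
    next
      case False
      then obtain j where j: "j \<in> {1..n}" "\<psi> (j, q j) = y" "p j \<noteq> q j" by blast
      have "\<not> b < j" using no_late j(1,2) by blast
      then have "j \<le> b" by simp
      have \<phi>j: "\<phi> (j, q j) = s" using refine[of "(j, q j)"] j qP xy by auto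
      have qj: "q j = q b'"
        using anti[OF j(1) b'(1) qP[OF j(1)] qP[OF b'(1)]] q_mono[OF j(1) b'(1)] \<phi>j b' \<open>j \<le> b\<close>
        by (auto intro: order.antisym)
      have "\<phi> (j, q b') \<le> \<phi> (b, q b')" "\<phi> (b, q b') \<le> \<phi> (b', q b')"
        using row[OF j(1) b(1) \<open>j \<le> b\<close>] row[OF b(1) b'(1,3)] qP[OF b'(1)] by blast+
      then have \<phi>b: "\<phi> (b, q b') = s" using \<phi>j qj b'(2) by simp
      have pb: "p b = q b'"
        using anti[OF b(1) b(1) qP[OF b'(1)] pP[OF b(1)]] qp \<phi>b b(2) by (auto intro: order.antisym)
      have "p j \<le> p b" using j b \<open>j \<le> b\<close> by (intro p_mono) auto
      then have pj: "\<not> p b \<le> p j" using j(3) qj pb by auto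
      have agree: "p l = q l" if l: "l \<in> {1..n}" "\<phi> (l, p l) = s" for l
      proof -
        have lb: "l \<le> b" using b(3) l by force
        then have "p b \<le> p l" "p l \<le> p b"
          using anti[OF l(1) b(1) pP[OF l(1)] pP[OF b(1)]] p_mono[OF l(1) b(1)] l b(2) by auto
        then have pl: "p l = p b" by simp
        have "j \<le> l"
        proof (rule ccontr)
          assume "\<not> j \<le> l"
          then show False using p_mono[OF l(1) j(1)] pl pj by simp
        qed
        then have "q j \<le> q l" "q l \<le> q b'"
          using lb l j b' by (auto intro!: q_mono)
        then show ?thesis using qj pb pl by simp
      qed
      have "word_count n \<psi> p x \<le> word_count n \<psi> q x"
      proof (rule word_count_le)
        fix l assume l: "l \<in> {1..n}" "\<psi> (l, p l) = x"
        then have "\<phi> (l, p l) = s" using refine[of "(l, p l)"] pP xy(2) by auto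
        then show "\<psi> (l, q l) = x" using agree[OF l(1)] l(2) by simp
      qed
      then have "word_count n \<psi> p c \<le> m c" for c
        using qy[of x] px[of c] xy(1) by (cases "c = x") auto
      then show ?thesis using p by blast
    qed
  qed
qed

lemma last_index_in_fiber:
  fixes \<phi> :: "nat \<times> 'p \<Rightarrow> 'r"
  assumes "\<exists>l\<in>{1..n}. \<phi> (l, p l) = s"
  obtains b where "b \<in> {1..n}" "\<phi> (b, p b) = s" "\<And>l. \<lbrakk>l \<in> {1..n}; b < l\<rbrakk> \<Longrightarrow> \<phi> (l, p l) \<noteq> s"
proof -
  let ?A = "{l \<in> {1..n}. \<phi> (l, p l) = s}"
  have A: "finite ?A" "?A \<noteq> {}" using assms by auto
  show ?thesis
  proof (rule that)
    show "Max ?A \<in> {1..n}" "\<phi> (Max ?A, p (Max ?A)) = s" using Max_in[OF A] by auto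
    show "\<phi> (l, p l) \<noteq> s" if "l \<in> {1..n}" "Max ?A < l" for l
    proof
      assume "\<phi> (l, p l) = s"
      then have "l \<le> Max ?A" using Max_ge[OF A(1), of l] that(1) by blast
      then show False using that(2) by simp
    qed
  qed
qed

text \<open>
  A multichain which does not fit into \<open>m\<close> itself visits the fiber of \<open>x\<close> and \<open>y\<close>. As the situation
  is symmetric in \<open>(x, p)\<close> and \<open>(y, q)\<close>, it does not matter whose last visit is the later one.
\<close>

lemma multichain_splice:
  fixes \<phi> :: "nat \<times> 'p::order \<Rightarrow> 'r::order" and \<psi> :: "nat \<times> 'p \<Rightarrow> 'c" and m :: "'c \<Rightarrow> nat"
  assumes mono: "mono_on ({1..n} \<times> P) \<phi>"
    and anti: "\<And>l l' p p'. \<lbrakk>l \<in> {1..n}; l' \<in> {1..n}; p \<in> P; p' \<in> P;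
        \<phi> (l, p) = \<phi> (l', p'); l \<le> l'\<rbrakk> \<Longrightarrow> p' \<le> p"
    and refine: "\<And>a. a \<in> {1..n} \<times> P \<Longrightarrow> \<theta> (\<psi> a) = \<phi> a"
    and xy: "x \<noteq> y" "\<theta> x = \<theta> y"
    and p: "p \<in> multichains n P" "\<And>c. word_count n \<psi> p c \<le> m c + (if c = x then 1 else 0)"
    and q: "q \<in> multichains n P" "\<And>c. word_count n \<psi> q c \<le> m c + (if c = y then 1 else 0)"
  shows "\<exists>w \<in> multichains n P. \<forall>c. word_count n \<psi> w c \<le> m c"
proof -
  have hits: "\<exists>l\<in>{1..n}. \<phi> (l, u l) = \<theta> z"
    if u: "u \<in> multichains n P" and z: "\<not> word_count n \<psi> u z \<le> m z" for u z
  proof -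
    from z have "{l \<in> {1..n}. \<psi> (l, u l) = z} \<noteq> {}"
      unfolding word_count_def by (metis card.empty le0)
    then obtain l where "l \<in> {1..n}" "\<psi> (l, u l) = z" by blast
    moreover have "u l \<in> P" using u \<open>l \<in> {1..n}\<close> by (auto simp: multichains_def)
    ultimately show ?thesis using refine[of "(l, u l)"] by auto
  qed
  show ?thesis
  proof (cases "word_count n \<psi> p x \<le> m x \<or> word_count n \<psi> q y \<le> m y")
    case True
    then show ?thesis
    proof
      assume "word_count n \<psi> p x \<le> m x"
      then have "word_count n \<psi> p c \<le> m c" for c using p(2)[of c] by (cases "c = x") auto
      then show ?thesis using p(1) by blast
    next
      assume "word_count n \<psi> q y \<le> m y"
      then have "word_count n \<psi> q c \<le> m c" for c using q(2)[of c] by (cases "c = y") auto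
      then show ?thesis using q(1) by blast
    qed
  next
    case False
    obtain b where b: "b \<in> {1..n}" "\<phi> (b, p b) = \<theta> x"
        "\<And>l. \<lbrakk>l \<in> {1..n}; b < l\<rbrakk> \<Longrightarrow> \<phi> (l, p l) \<noteq> \<theta> x"
      using last_index_in_fiber[OF hits[OF p(1), of x]] False by blast
    obtain b' where b': "b' \<in> {1..n}" "\<phi> (b', q b') = \<theta> x"
        "\<And>l. \<lbrakk>l \<in> {1..n}; b' < l\<rbrakk> \<Longrightarrow> \<phi> (l, q l) \<noteq> \<theta> x"
      using last_index_in_fiber[OF hits[OF q(1), of y]] False xy(2) by auto
    show ?thesis
    proof (cases "b \<le> b'")
      case True
      show ?thesis
        by (rule multichain_splice_ordered[OF mono anti refine xy(1) refl xy(2)[symmetric]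
              p q b b'(1,2) True])
    next
      case False
      then have "b' \<le> b" by simp
      show ?thesis
        by (rule multichain_splice_ordered[OF mono anti refine xy(1)[symmetric] xy(2)[symmetric] refl
              q p b' b(1,2) \<open>b' \<le> b\<close>])
    qed
  qed
qed

section \<open>The letterplace ideal\<close>

definition multichain_exponent :: "nat \<Rightarrow> (nat \<Rightarrow> 'p) \<Rightarrow> (nat \<times> 'p \<Rightarrow>\<^sub>0 nat)" where
  "multichain_exponent n p = (\<Sum>l\<in>{1..n}. Poly_Mapping.single (l, p l) 1)"

lemma prod_monomial: "(\<Prod>i\<in>I. monomial (m i)) = monomial (\<Sum>i\<in>I. m i)"
  by (induction I rule: infinite_finite_induct) (simp_all add: mult_single)

lemma letterplace_ideal_eq:
  "letterplace_ideal n P =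
     Idl\<^bsub>poly_ring ({1..n} \<times> P)\<^esub> (monomial ` multichain_exponent n ` multichains n P)"
  unfolding letterplace_ideal_def multichains_def var_def prod_monomial multichain_exponent_def
  by (rule arg_cong[where f = "genideal _"]) blast

lemma keys_multichain_exponent:
  assumes "p \<in> multichains n P"
  shows "Poly_Mapping.keys (multichain_exponent n p) \<subseteq> {1..n} \<times> P"
proof -
  have "Poly_Mapping.keys (multichain_exponent n p)
      \<subseteq> (\<Union>l\<in>{1..n}. Poly_Mapping.keys (Poly_Mapping.single (l, p l) (1::nat)))"
    unfolding multichain_exponent_def by (rule keys_sum)
  also have "\<dots> \<subseteq> {1..n} \<times> P" using assms by (auto simp: multichains_def)
  finally show ?thesis .
qed

lemma lookup_rename_multichain_exponent:
  "Poly_Mapping.lookup (rename_exponent \<psi> (multichain_exponent n p)) c = word_count n \<psi> p c"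
proof -
  have "Poly_Mapping.lookup (rename_exponent \<psi> (multichain_exponent n p)) c
      = (\<Sum>l\<in>{1..n}. if \<psi> (l, p l) = c then 1 else 0)"
    by (simp add: multichain_exponent_def rename_exponent_sum rename_exponent_single lookup_sum
        lookup_single when_def del: One_nat_def)
  also have "\<dots> = word_count n \<psi> p c"
    unfolding word_count_def card_eq_sum by (rule sum.inter_filter[symmetric]) simp
  finally show ?thesis .
qed

lemma in_renamed_letterplace_iff:
  "m \<in> {u + rename_exponent \<psi> g | u g. g \<in> multichain_exponent n ` multichains n P} \<longleftrightarrow>
     (\<exists>p\<in>multichains n P. \<forall>c. word_count n \<psi> p c \<le> Poly_Mapping.lookup m c)"
proof
  assume "m \<in> {u + rename_exponent \<psi> g | u g. g \<in> multichain_exponent n ` multichains n P}"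
  then obtain u p where "p \<in> multichains n P" "m = u + rename_exponent \<psi> (multichain_exponent n p)"
    by blast
  then show "\<exists>p\<in>multichains n P. \<forall>c. word_count n \<psi> p c \<le> Poly_Mapping.lookup m c"
    by (intro bexI[of _ p]) (simp_all add: lookup_add lookup_rename_multichain_exponent)
next
  assume "\<exists>p\<in>multichains n P. \<forall>c. word_count n \<psi> p c \<le> Poly_Mapping.lookup m c"
  then obtain p where p: "p \<in> multichains n P" "\<And>c. word_count n \<psi> p c \<le> Poly_Mapping.lookup m c"
    by blast
  let ?g = "rename_exponent \<psi> (multichain_exponent n p)"
  have "m = (m - ?g) + ?g"
    using p(2) by (intro poly_mapping_eqI)
      (simp add: lookup_add lookup_minus lookup_rename_multichain_exponent)
  then show "m \<in> {u + rename_exponent \<psi> g | u g. g \<in> multichain_exponent n ` multichains n P}"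
    using p(1) by blast
qed

lemma inj_var: "var a = (var b :: ('v, 'k::comm_ring_1) mpoly) \<longleftrightarrow> a = b"
proof
  assume "var a = (var b :: ('v, 'k) mpoly)"
  then have "Poly_Mapping.keys (var a :: ('v, 'k) mpoly) = Poly_Mapping.keys (var b :: ('v, 'k) mpoly)"
    by (rule arg_cong)
  then have "Poly_Mapping.single a (1::nat) = Poly_Mapping.single b 1" by (simp add: var_def)
  then have "Poly_Mapping.keys (Poly_Mapping.single a (1::nat)) = Poly_Mapping.keys (Poly_Mapping.single b (1::nat))"
    by (rule arg_cong)
  then show "a = b" by simp
qed simp

lemma span_subset_ideal_poly_ring:
  fixes K :: "('v, 'k::field) mpoly set"
  assumes K: "ideal K (poly_ring A)" and X: "X \<subseteq> K"
  shows "poly.span X \<subseteq> K"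
proof (rule poly.span_minimal[OF X])
  show "poly.subspace K"
    unfolding poly.subspace_def poly_scale_conv_mult
    by (intro conjI ballI allI ideal_poly_ringD[OF K] single_in_poly_ring) simp_all
qed

theorem theorem2p1:
  fixes n :: nat
    and P :: "'p::order set"
    and R :: "'r::order set"
    and \<phi> :: "nat \<times> 'p \<Rightarrow> 'r"
    and bs :: "(nat \<times> 'p, 'k::field) mpoly list"
  assumes "n \<ge> 1"
    and "finite P"
    and "\<phi> \<in> {1..n} \<times> P \<rightarrow> R"
    and "mono_on ({1..n} \<times> P) \<phi>"
    and "left_strict_chain_fibers {1..n} P R \<phi>"
    and "distinct bs"
    and "is_basis_of (set bs) (linear_map_kernel ({1..n} \<times> P) \<phi>)"
    and "set bs \<subseteq> {var a - var a' | a a'.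
           a \<in> {1..n} \<times> P \<and> a' \<in> {1..n} \<times> P \<and> \<phi> a = \<phi> a'}"
  shows "regular_sequence
           (poly_ring ({1..n} \<times> P) Quot letterplace_ideal n P)
           (map (\<lambda>b. letterplace_ideal n P +>\<^bsub>poly_ring ({1..n} \<times> P)\<^esub> b) bs)"
proof -
  define A where "A = {1..n} \<times> P"
  let ?S = "multichain_exponent n ` multichains n P"
  let ?PR = "poly_ring A :: (nat \<times> 'p, 'k) mpoly ring"
  let ?L = "letterplace_ideal n P :: (nat \<times> 'p, 'k) mpoly set"
  interpret cring ?PR by (rule cring_poly_ring)
  interpret lm: Vector_Spaces.linear poly_scale poly_scale
      "linear_map A \<phi> :: (nat \<times> 'p, 'k) mpoly \<Rightarrow> ('r, 'k) mpoly"
    by (rule linear_linear_map)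
  have finA: "finite A" using assms(2) by (simp add: A_def)
  have anti: "p' \<le> p" if "l \<in> {1..n}" "l' \<in> {1..n}" "p \<in> P" "p' \<in> P" "\<phi> (l, p) = \<phi> (l', p')" "l \<le> l'"
    for l l' p p'
    using left_strict_chain_fibers_antimono[OF assms(5,3)] that by blast
  have indep: "poly.independent (set bs)" and ker: "poly.span (set bs) = linear_map_kernel A \<phi>"
    using assms(7) by (auto simp: is_basis_of_def A_def)
  have bs_form: "\<exists>a a'. b = var a - var a' \<and> a \<in> A \<and> a' \<in> A \<and> \<phi> a = \<phi> a'" if "b \<in> set bs" for b
    using assms(8) that by (auto simp: A_def)
  have S: "Poly_Mapping.keys g \<subseteq> A" if "g \<in> ?S" for g
    using that keys_multichain_exponent unfolding A_def by blast
  have L_eq: "?L = Idl\<^bsub>?PR\<^esub> (monomial ` ?S)" unfolding A_def by (rule letterplace_ideal_eq)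
  have L: "ideal ?L ?PR"
    unfolding L_eq by (intro genideal_ideal image_subsetI single_in_poly_ring S)
  have diff_carrier: "(var a - var a' :: (nat \<times> 'p, 'k) mpoly) \<in> carrier ?PR" if "a \<in> A" "a' \<in> A" for a a'
    by (intro diff_in_poly_ring var_in_poly_ring that)
  have bs_carrier: "set bs \<subseteq> carrier ?PR" using bs_form diff_carrier by blast
  have "regular_sequence (?PR Quot ?L) (map (\<lambda>b. ?L +>\<^bsub>?PR\<^esub> b) bs)"
  proof (rule regular_sequence_quotI[OF L bs_carrier])
    fix i and f :: "(nat \<times> 'p, 'k) mpoly"
    assume i: "i < length bs" and f: "f \<in> carrier ?PR"
    define X where "X = set (take i bs)"
    define K where "K = Idl\<^bsub>?PR\<^esub> (?L \<union> X)"
    assume prod: "bs ! i \<otimes>\<^bsub>?PR\<^esub> f \<in> Idl\<^bsub>?PR\<^esub> (?L \<union> set (take i bs))"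
    have X_bs: "X \<subseteq> set bs" unfolding X_def by (rule set_take_subset)
    have X: "X \<subseteq> carrier ?PR" using X_bs bs_carrier by blast
    have LX: "?L \<union> X \<subseteq> carrier ?PR" using X ideal.Icarr[OF L] by blast
    have K: "ideal K ?PR" unfolding K_def by (rule genideal_ideal[OF LX])
    have span_K: "poly.span X \<subseteq> K"
      using genideal_self[OF LX] by (intro span_subset_ideal_poly_ring[OF K]) (auto simp: K_def)
    \<comment> \<open>Two variables are identified by the first \<open>i\<close> elements if their difference lies in the linear
      span of these. This is an equivalence relation, so the choice depends on the class only.\<close>
    define \<psi> where "\<psi> a = (SOME a'. a' \<in> A \<and> var a - var a' \<in> poly.span X)" for a
    have \<psi>: "\<psi> a \<in> A \<and> var a - var (\<psi> a) \<in> poly.span X" if "a \<in> A" for a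
      unfolding \<psi>_def by (rule someI[of _ a]) (simp add: that poly.span_zero)
    have \<psi>_A: "\<psi> \<in> A \<rightarrow> A" using \<psi> by blast
    have \<psi>_eq: "\<psi> a = \<psi> a'" if "var a - var a' \<in> poly.span X" for a a'
    proof -
      have "var a - var c \<in> poly.span X \<longleftrightarrow> var a' - var c \<in> poly.span X" for c
        using poly.span_diff[OF _ that, of "var a - var c"] poly.span_add[OF that, of "var a' - var c"]
        by auto
      then show ?thesis by (simp add: \<psi>_def)
    qed
    \<comment> \<open>the span lies in the kernel, so a class cannot leave its fiber\<close>
    have \<phi>\<psi>: "\<phi> (\<psi> a) = \<phi> a" if a: "a \<in> A" for a
    proof -
      have "(var a - var (\<psi> a) :: (nat \<times> 'p, 'k) mpoly) \<in> linear_map_kernel A \<phi>"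
        using \<psi>[OF a] poly.span_mono[OF X_bs] ker by blast
      then have "linear_map A \<phi> (var a - var (\<psi> a) :: (nat \<times> 'p, 'k) mpoly) = 0"
        by (simp add: linear_map_kernel_def)
      then have "(var (\<phi> a) :: ('r, 'k) mpoly) = var (\<phi> (\<psi> a))"
        using \<psi>[OF a] a finA by (simp add: lm.diff linear_map_var)
      then show ?thesis by (simp add: inj_var)
    qed
    have X_0: "rename_vars \<psi> b = 0" if "b \<in> X" for b
    proof -
      obtain a a' where "b = var a - var a'" using bs_form X_bs \<open>b \<in> X\<close> by blast
      then show ?thesis
        using \<psi>_eq[of a a'] poly.span_base[OF that] by (simp add: rename_vars_diff rename_vars_var)
    qed
    define M where "M = {u + rename_exponent \<psi> g | u g. g \<in> ?S}"
    have in_M: "m \<in> M \<longleftrightarrow> (\<exists>p\<in>multichains n P. \<forall>c. word_count n \<psi> p c \<le> Poly_Mapping.lookup m c)" for m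
      unfolding M_def by (rule in_renamed_letterplace_iff)
    have in_K: "h \<in> K \<longleftrightarrow> Poly_Mapping.keys (rename_vars \<psi> h) \<subseteq> M" if "h \<in> carrier ?PR" for h
      unfolding K_def L_eq M_def
      by (rule in_genideal_monomials_Un_iff[OF \<psi>_A S X X_0 _ that])
        (use \<psi> span_K in \<open>auto simp: K_def L_eq\<close>)
    have b_in: "bs ! i \<in> set bs" using i by simp
    then obtain a a' where b: "bs ! i = var a - var a'" and aa': "a \<in> A" "a' \<in> A" "\<phi> a = \<phi> a'"
      using bs_form by blast
    have b_carrier: "bs ! i \<in> carrier ?PR" using b_in bs_carrier by blast
    have neq: "\<psi> a \<noteq> \<psi> a'"
    proof
      assume "\<psi> a = \<psi> a'"
      then have "bs ! i = (var a - var (\<psi> a)) - (var a' - var (\<psi> a'))" by (simp add: b)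
      also have "\<dots> \<in> poly.span X" using \<psi>[OF aa'(1)] \<psi>[OF aa'(2)] by (blast intro: poly.span_diff)
      also have "\<dots> \<subseteq> poly.span (set bs - {bs ! i})"
      proof (rule poly.span_mono)
        have "bs ! i \<notin> X"
          using assms(6) i by (auto simp: X_def in_set_conv_nth nth_eq_iff_index_eq)
        then show "X \<subseteq> set bs - {bs ! i}" using X_bs by blast
      qed
      finally show False using indep b_in by (auto simp: poly.dependent_def)
    qed
    have "Poly_Mapping.keys (rename_vars \<psi> f) \<subseteq> M"
    proof (rule keys_subset_if_keys_var_diff_mult_subset)
      show "\<psi> a \<noteq> \<psi> a'" by (rule neq)
      have "bs ! i * f \<in> K" using prod by (simp add: K_def X_def poly_ring_simps)
      then show "Poly_Mapping.keys ((var (\<psi> a) - var (\<psi> a')) * rename_vars \<psi> f) \<subseteq> M"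
        using in_K[of "bs ! i * f"] m_closed[OF b_carrier f]
        by (simp add: poly_ring_simps rename_vars_mult b rename_vars_diff rename_vars_var)
      show "u + m \<in> M" if "m \<in> M" for m u
        using that unfolding in_M by (fastforce simp: lookup_add intro: trans_le_add2)
    next
      fix m
      assume "expo (\<psi> a) + m \<in> M" "expo (\<psi> a') + m \<in> M"
      then obtain p q where p: "p \<in> multichains n P"
          "\<And>c. word_count n \<psi> p c \<le> Poly_Mapping.lookup (expo (\<psi> a) + m) c"
        and q: "q \<in> multichains n P"
          "\<And>c. word_count n \<psi> q c \<le> Poly_Mapping.lookup (expo (\<psi> a') + m) c"
        unfolding in_M by blast
      have lookup_expo: "Poly_Mapping.lookup (expo z + m) c
          = Poly_Mapping.lookup m c + (if c = z then 1 else 0)" for z c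
        by (simp add: lookup_add lookup_single when_def)
      have "\<phi> (\<psi> a) = \<phi> (\<psi> a')" using \<phi>\<psi> aa' by simp
      \<comment> \<open>a class is named by its representative, so \<open>\<phi>\<close> itself assigns to it its fiber\<close>
      from multichain_splice[where \<theta> = \<phi>, OF assms(4) anti \<phi>\<psi>[unfolded A_def] neq this
          p[unfolded lookup_expo] q[unfolded lookup_expo]]
      show "m \<in> M" unfolding in_M .
    qed
    then show "f \<in> Idl\<^bsub>?PR\<^esub> (?L \<union> set (take i bs))"
      using in_K[OF f] by (simp add: K_def X_def)
  qed
  then show ?thesis by (simp only: A_def)
qed

end
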